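(* For an integer $V\ge 1$ let $\mathcal R_V=\{(i,j)\in\mathbb N^2: T_{i,j}\le V\}$, and for $(i,j)\in\mathbb N^2$ write $\rho=\rho(i,j)=\pi i+2j$. There is an absolute constant $K$ such that, for all sufficiently large integers $V$, $$\big\{(i,j)\in\mathbb N^2:\rho\le 2\sqrt{\pi V}-2-KV^{1/6}\big\}\subseteq\mathcal R_V\subseteq\big\{(i,j)\in\mathbb N^2:\rho\le 2\sqrt{\pi V}-2+KV^{1/6}\big\}.$$
   Context: $\mathbb N=\{0,1,2,\dots\}$. For each integer $n\ge1$ let $T^{(n)}$ be the array of positive integers with entries $T^{(n)}_{i,j}$ (rows $i\ge0$, columns $0\le j<n$) defined recursively by $T^{(1)}_{q,0}=q+1$ for $q\ge0$, and, for $n\ge1$, $0\le j\le n$ and a row index written uniquely as $i=qn+r$ with $q\ge0$, $0\le r<n$, $$T^{(n+1)}_{qn+r,\,j}=\begin{cases}T^{(n)}_{q(n+1)+r,\,j}, & j+r<n,\\ T^{(n)}_{q(n+1)+r+1,\,j-1}, & j+r\ge n.\end{cases}$$ For fixed $i,j\ge0$ the entry $T^{(n)}_{i,j}$ is independent of $n$ for $n\ge i+j+1$. The Tchoukaillon array is the limiting array $T_{i,j}:=T^{(i+j+1)}_{i,j}$, $i,j\ge0$. *)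

theory Defs
  imports "HOL-Analysis.Analysis"
begin

text \<open>
  \<open>tarray n i j\<close> is the entry in row \<open>i\<close> and column \<open>j\<close> of the \<open>n\<close>-th array; it is
  meaningful only for \<open>n \<ge> 1\<close> and \<open>j < n\<close>. The recursion never leaves this range: in the
  last branch \<open>r < n \<le> j + r\<close> forces \<open>j \<ge> 1\<close>, so \<open>j - 1\<close> is not truncated.
\<close>

fun tarray :: "nat \<Rightarrow> nat \<Rightarrow> nat \<Rightarrow> nat" where
  "tarray 0 i j = 0"
| "tarray (Suc 0) i j = i + 1"
| "tarray (Suc (Suc m)) i j =
     (let n = Suc m; q = i div n; r = i mod n
      in if j + r < n then tarray n (q * (n + 1) + r) j
         else tarray n (q * (n + 1) + r + 1) (j - 1))"

definition tchoukaillon :: "nat \<Rightarrow> nat \<Rightarrow> nat" where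
  "tchoukaillon i j = tarray (i + j + 1) i j"

lemma tarray_stable:
  assumes "i + j + 1 \<le> n"
  shows "tarray n i j = tchoukaillon i j"
  using assms
proof (induction n rule: dec_induct)
  case base
  then show ?case by (simp add: tchoukaillon_def)
next
  case (step n)
  then obtain m where "n = Suc m" by (cases n) auto
  with step show ?case by (simp add: Let_def)
qed

definition tregion :: "nat \<Rightarrow> (nat \<times> nat) set" where
  "tregion V = {(i, j). tchoukaillon i j \<le> V}"

definition rho :: "nat \<Rightarrow> nat \<Rightarrow> real" where
  "rho i j = pi * real i + 2 * real j"

end

theory Submission
  imports Defs
begin

text \<open>
  Put \<open>s = i + j\<close>. One step of the array recursion, from the array of width \<open>n + 1\<close> to that of
  width \<open>n\<close>, replaces \<open>(i, s)\<close> by \<open>(i + \<lfloor>s / n\<rfloor>, s + \<lfloor>i / n\<rfloor>)\<close>, and \<open>T\<^sub>i\<^sub>j - 1\<close> is the common value of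
  both coordinates after the step with \<open>n = 1\<close>. While \<open>\<lfloor>i / n\<rfloor> = a\<close> and \<open>\<lfloor>s / n\<rfloor> = b\<close>, the
  quantities \<open>i + b n\<close> and \<open>s + a n\<close> are conserved. Their successive values \<open>D\<^sub>k\<close> (for \<open>b = k\<close>) and
  \<open>C\<^sub>k\<close> (for \<open>a = k\<close>) satisfy the Wallis-type recursion
  \<open>D\<^sub>k\<^sub>+\<^sub>1 = D\<^sub>k + \<lfloor>C\<^sub>k / (2k + 1)\<rfloor>\<close>, \<open>C\<^sub>k\<^sub>+\<^sub>1 = C\<^sub>k + \<lfloor>D\<^sub>k\<^sub>+\<^sub>1 / (2k + 2)\<rfloor>\<close>, whose version without rounding
  has a linear invariant equal to \<open>\<rho>(i, j)\<close> at the start.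

  Follow this recursion up to \<open>k\<close>: rounding costs \<open>O(\<surd>k)\<close> in \<open>\<rho>\<close>. There \<open>n \<approx> D\<^sub>k / 2k\<close>, and the
  remaining \<open>n\<close> steps multiply \<open>i + s\<close> by \<open>n + 1\<close> up to an error \<open>O(n\<^sup>2)\<close>. The choice
  \<open>k \<approx> V\<^sup>1\<^sup>/\<^sup>3\<close> balances the two errors.
\<close>

section \<open>The array recursion as a descent on pairs\<close>

fun trajectory :: "nat \<Rightarrow> nat \<Rightarrow> nat \<Rightarrow> nat \<times> nat" where
  "trajectory i s 0 = (i, s)"
| "trajectory i s (Suc t) =
     (let (a, b) = trajectory i s t in (a + b div (s - t), b + a div (s - t)))"

text \<open>The pairs \<open>(D\<^sub>k, C\<^sub>k)\<close> of conserved quantities.\<close>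

fun phase :: "nat \<Rightarrow> nat \<Rightarrow> nat \<Rightarrow> nat \<times> nat" where
  "phase i s 0 = (i, s)"
| "phase i s (Suc k) =
     (let (D, C) = phase i s k; D' = D + C div (2 * k + 1) in (D', C + D' div (2 * k + 2)))"

text \<open>With \<open>i = q * n + r\<close> and \<open>j = s - i \<le> n\<close>, the quotient
  \<open>s div n\<close> is \<open>q\<close> or \<open>q + 1\<close>, and it is \<open>q + 1\<close>
  exactly when \<open>j + r \<ge> n\<close>. So the two floors encode the case distinction of the
  recursion, and the new column is the difference of the new pair.\<close>

lemma tarray_step:
  assumes "0 < n" "i \<le> s" "s \<le> i + n"
  shows "tarray (Suc n) i (s - i) = tarray n (i + s div n) (s + i div n - (i + s div n))"
    and "i + s div n \<le> s + i div n" and "s + i div n < i + s div n + n"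
proof -
  define q r j where "q = i div n" and "r = i mod n" and "j = s - i"
  have i: "i = q * n + r" and r: "r < n" and s: "s = q * n + (r + j)" and j: "j \<le> n"
    using assms by (auto simp: q_def r_def j_def)
  have sd: "s div n = q + (r + j) div n"
    using assms s by simp
  obtain m where m: "n = Suc m" using assms by (cases n) auto
  have "(r + j) div n = (if r + j < n then 0 else 1)"
    using r j assms by (auto simp: div_nat_eqI)
  then have sd: "s div n = q + (if r + j < n then 0 else 1)" using sd by simp
  have t: "tarray (Suc n) i j =
     (if j + r < n then tarray n (q * (n + 1) + r) j
         else tarray n (q * (n + 1) + r + 1) (j - 1))"
    unfolding m by (simp add: Let_def q_def r_def m)
  have idn: "i div n = q" by (simp add: q_def)
  show "tarray (Suc n) i (s - i) = tarray n (i + s div n) (s + i div n - (i + s div n))"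
    unfolding j_def[symmetric] t sd idn
    using i s by (auto simp: algebra_simps)
  show "i + s div n \<le> s + i div n" "s + i div n < i + s div n + n"
    unfolding sd idn using i s r j by (auto split: if_splits)
qed

lemma tchoukaillon_trajectory:
  obtains I S :: "nat \<Rightarrow> nat" where
    "I (i + j) = i" "S (i + j) = i + j"
    "\<And>n. I n = I (Suc n) + S (Suc n) div Suc n" "\<And>n. S n = S (Suc n) + I (Suc n) div Suc n"
    "\<And>n. I n \<le> S n" "\<And>n. S n \<le> I n + n" "tchoukaillon i j = Suc (I 0)"
proof -
  define s where "s = i + j"
  \<comment> \<open>The index \<open>n\<close> is the next divisor, so \<open>(I n, S n)\<close>
    belongs to the array of width \<open>n + 1\<close>. For \<open>n \<ge> s\<close> truncated
    subtraction freezes the pair at \<open>(i, s)\<close>; all floors vanish there, so the recursion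
    holds for every \<open>n\<close>.\<close>
  define I S where "I = (\<lambda>n. fst (trajectory i s (s - n)))" and "S = (\<lambda>n. snd (trajectory i s (s - n)))"
  have I: "I n = I (Suc n) + S (Suc n) div Suc n"
   and S: "S n = S (Suc n) + I (Suc n) div Suc n" for n
  proof -
    have "I n = I (Suc n) + S (Suc n) div Suc n \<and> S n = S (Suc n) + I (Suc n) div Suc n"
    proof (cases "n < s")
      case True
      then have "s - n = Suc (s - Suc n)" "s - (s - Suc n) = Suc n" by auto
      then show ?thesis by (simp add: I_def S_def case_prod_beta Let_def)
    next
      case False
      then show ?thesis by (simp add: I_def S_def s_def)
    qed
    then show "I n = I (Suc n) + S (Suc n) div Suc n" "S n = S (Suc n) + I (Suc n) div Suc n" by auto
  qed
  have top: "I n = i" "S n = s" if "n \<ge> s" for n using that by (auto simp: I_def S_def)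
  have inv: "I n \<le> S n \<and> S n \<le> I n + n \<and> tarray (Suc n) (I n) (S n - I n) = tchoukaillon i j" for n
  proof (cases "n \<le> s")
    case True
    then show ?thesis
    proof (induction n rule: inc_induct)
      case base
      then show ?case by (simp add: top tchoukaillon_def) (simp add: s_def)
    next
      case (step n)
      then have "0 < Suc n" "I (Suc n) \<le> S (Suc n)" "S (Suc n) \<le> I (Suc n) + Suc n" by auto
      note * = tarray_step[OF this, folded I S]
      have "S n \<le> I n + n" using *(3) by linarith
      then show ?case using *(1,2) step.IH by metis
    qed
  next
    case False
    then show ?thesis using tarray_stable[of i j "Suc n"] by (simp add: top) (simp add: s_def)
  qed
  show thesis
  proof
    show "I (i + j) = i" "S (i + j) = i + j" using top by (auto simp: s_def)
    show "tchoukaillon i j = Suc (I 0)" using inv[of 0] by simp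
    show "I n \<le> S n" "S n \<le> I n + n" for n using inv by blast+
  qed (rule I S)+
qed

section \<open>Phases of constant quotients, and the steps after them\<close>

lemma nat_div_bounds:
  fixes a d :: nat
  assumes "0 < d"
  shows "d * (a div d) \<le> a" and "a < d * Suc (a div d)"
  using dividend_less_times_div[OF assms, of a] by simp_all

text \<open>The quotients of \<open>(I, S)\<close> run through (0,0), (0,1), (1,1), (1,2), and so
  on: \<open>I \<le> S \<le> I + n\<close> forces the two to increase alternately. From (k,k), the
  quotient of \<open>S\<close> first reaches \<open>k + 1\<close> when
  \<open>B k - k * n \<ge> (k + 1) * n\<close>, that is at \<open>n = B k div (2 * k + 1)\<close>.
  From (k,k+1), that of \<open>I\<close> does so at \<open>A (Suc k) div (2 * k + 2)\<close>. These
  are the divisors in \<open>phase\<close>.\<close>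

lemma phase_trajectory:
  fixes I S :: "nat \<Rightarrow> nat"
  assumes init: "I s = i" "S s = s"
    and I: "\<And>n. I n = I (Suc n) + S (Suc n) div Suc n"
    and S: "\<And>n. S n = S (Suc n) + I (Suc n) div Suc n"
    and le: "\<And>n. I n \<le> S n" and gap: "\<And>n. S n \<le> I n + n"
    and DC: "phase i s (Suc k) = (D, C)"
  defines "M \<equiv> D div (2 * k + 2)"
  shows "I M + Suc k * M = D" and "S M + Suc k * M = C"
proof -
  define A where "A = (\<lambda>k. fst (phase i s k))"
  define B where "B = (\<lambda>k. snd (phase i s k))"
  have A: "A (Suc k) = A k + B k div (2 * k + 1)" for k
    by (simp add: A_def B_def case_prod_beta Let_def)
  have B: "B (Suc k) = B k + A (Suc k) div (2 * k + 2)" for k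
    by (simp add: A_def B_def case_prod_beta Let_def)
  \<comment> \<open>Descent through the divisors \<open>n\<close> down to \<open>m + 1\<close> with
    quotients \<open>a\<close> and \<open>b\<close>. The range check at \<open>l\<close> may assume
    the conserved values at \<open>l\<close>, since the induction delivers them.\<close>
  have desc: "I m + b * m = a1 \<and> S m + a * m = a2"
    if "m \<le> n" "I n + b * n = a1" "S n + a * n = a2"
      and *: "\<And>l. m < l \<Longrightarrow> l \<le> n \<Longrightarrow> I l + b * l = a1 \<Longrightarrow> S l + a * l = a2 \<Longrightarrow>
              a * l \<le> I l \<and> I l < Suc a * l \<and> b * l \<le> S l \<and> S l < Suc b * l"
    for m n a b a1 a2
    using that(1) *
  proof (induction m rule: inc_induct)
    case base
    then show ?case using that by simp
  next
    case (step m)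
    have e: "I (Suc m) + b * Suc m = a1" "S (Suc m) + a * Suc m = a2"
      using step by auto
    have "a * Suc m \<le> I (Suc m) \<and> I (Suc m) < Suc a * Suc m
      \<and> b * Suc m \<le> S (Suc m) \<and> S (Suc m) < Suc b * Suc m"
      using step.prems[OF _ _ e] step.hyps by auto
    then have "I (Suc m) div Suc m = a" "S (Suc m) div Suc m = b"
      by (auto intro!: div_nat_eqI simp: algebra_simps)
    then show ?case using e I[of m] S[of m] by simp
  qed
  \<comment> \<open>The stretch with quotients (k,k+1). At its upper end \<open>n\<close> the
    quotient of \<open>S\<close> is already \<open>k + 1\<close>, hence the new constant
    \<open>A k + n\<close> for \<open>I\<close>.\<close>
  have half: "I m + Suc k * m = A (Suc k) \<and> S m + Suc k * m = B (Suc k)"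
    if n: "n = B k div (2 * k + 1)" and m: "m = A (Suc k) div (2 * k + 2)"
      and e: "I n + k * n = A k" "S n + k * n = B k" for k n m
  proof -
    have n1: "(2 * k + 1) * n \<le> B k" "B k < (2 * k + 1) * Suc n"
      unfolding n by (intro nat_div_bounds; simp)+
    have m1: "(2 * k + 2) * m \<le> A (Suc k)" "A (Suc k) < (2 * k + 2) * Suc m"
      unfolding m by (intro nat_div_bounds; simp)+
    have A': "A (Suc k) = A k + n" using A n by simp
    have "A (Suc k) < (2 * k + 2) * Suc n"
      using n1 e le[of n] A' by (simp add: algebra_simps)
    then have "(2 * k + 2) * m < (2 * k + 2) * Suc n" using m1 by linarith
    then have mn: "m \<le> n" by (simp only: mult_less_cancel1 less_Suc_eq_le)
    have "I m + Suc k * m = A (Suc k) \<and> S m + k * m = B k"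
    proof (rule desc[OF mn])
      fix l assume l: "m < l" "l \<le> n" and el: "I l + Suc k * l = A (Suc k)" "S l + k * l = B k"
      have 1: "(2 * k + 2) * Suc m \<le> (2 * k + 2) * l" using l by (intro mult_le_mono) auto
      have 2: "(2 * k + 1) * l \<le> (2 * k + 1) * n" using l by (intro mult_le_mono) auto
      have 3: "Suc k * l \<le> S l" "I l < Suc k * l"
        using el m1 n1 1 2 by (auto simp: algebra_simps)
      then show "k * l \<le> I l \<and> I l < Suc k * l \<and> Suc k * l \<le> S l \<and> S l < Suc (Suc k) * l"
        using gap[of l] by auto
    qed (use e A' in auto)
    then show ?thesis using B[of k] m by simp
  qed
  \<comment> \<open>Alternates \<open>half\<close> with the stretch of quotients (k+1,k+1). For
    \<open>k = 0\<close> the divisor is \<open>s\<close> itself, where nothing has moved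
    yet.\<close>
  have full: "I n + k * n = A k \<and> S n + k * n = B k" if "n = B k div (2 * k + 1)" for k n
    using that
  proof (induction k arbitrary: n)
    case 0
    then show ?case by (simp add: A_def B_def init)
  next
    case (Suc k)
    define m where "m = A (Suc k) div (2 * k + 2)"
    have e: "I m + Suc k * m = A (Suc k)" "S m + Suc k * m = B (Suc k)"
      using half[OF refl m_def] Suc.IH by auto
    have n1: "(2 * Suc k + 1) * n \<le> B (Suc k)" "B (Suc k) < (2 * Suc k + 1) * Suc n"
      unfolding Suc.prems by (intro nat_div_bounds; simp)+
    have m1: "(2 * k + 2) * m \<le> A (Suc k)" "A (Suc k) < (2 * k + 2) * Suc m"
      unfolding m_def by (intro nat_div_bounds; simp)+
    have "B (Suc k) < (2 * Suc k + 1) * Suc m"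
      using m1 e gap[of m] by (simp add: algebra_simps)
    then have "(2 * Suc k + 1) * n < (2 * Suc k + 1) * Suc m" using n1 by linarith
    then have mn: "n \<le> m" by (simp only: mult_less_cancel1 less_Suc_eq_le)
    show ?case
    proof (rule desc[OF mn])
      fix l assume l: "n < l" "l \<le> m" and el: "I l + Suc k * l = A (Suc k)" "S l + Suc k * l = B (Suc k)"
      have 1: "(2 * Suc k + 1) * Suc n \<le> (2 * Suc k + 1) * l" using l by (intro mult_le_mono) auto
      have 2: "(2 * k + 2) * l \<le> (2 * k + 2) * m" using l by (intro mult_le_mono) auto
      have 3: "Suc k * l \<le> I l" "S l < Suc (Suc k) * l"
        using el m1 n1 1 2 by (auto simp: algebra_simps)
      then show "Suc k * l \<le> I l \<and> I l < Suc (Suc k) * l \<and> Suc k * l \<le> S l \<and> S l < Suc (Suc k) * l"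
        using le[of l] by auto
    qed (use e in auto)
  qed
  have D: "A (Suc k) = D" "B (Suc k) = C" using DC by (simp_all add: A_def B_def del: phase.simps)
  have "M = A (Suc k) div (2 * k + 2)" using M_def D by simp
  from half[OF refl this] full[OF refl, of k] D
  show "I M + Suc k * M = D" "S M + Suc k * M = C" by auto
qed

text \<open>Without rounding \<open>(n + 1) * u n\<close> would be constant. The two floors taken
  with divisor \<open>n + 1\<close> lower it by at most \<open>2 * (n + 1)\<close>, and these losses
  add up to \<open>n * (n + 1)\<close>.\<close>

lemma trajectory_total:
  fixes I S :: "nat \<Rightarrow> nat" and n :: nat
  assumes I: "\<And>n. I n = I (Suc n) + S (Suc n) div Suc n"
    and S: "\<And>n. S n = S (Suc n) + I (Suc n) div Suc n"
  defines "u \<equiv> \<lambda>n. real (I n) + real (S n)"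
  shows "u 0 \<le> (real n + 1) * u n" and "(real n + 1) * u n - real n * (real n + 1) \<le> u 0"
proof -
  have step: "(real n + 1) * u n \<le> (real n + 2) * u (Suc n)"
    "(real n + 2) * u (Suc n) - 2 * (real n + 1) \<le> (real n + 1) * u n" for n
  proof -
    have d: "real a \<le> (real n + 1) * real (a div Suc n) + (real n + 1)"
      "(real n + 1) * real (a div Suc n) \<le> real a" for a
    proof -
      have "real a < real (Suc n * Suc (a div Suc n))" "real (Suc n * (a div Suc n)) \<le> real a"
        using nat_div_bounds[of "Suc n" a] by linarith+
      then show "real a \<le> (real n + 1) * real (a div Suc n) + (real n + 1)"
        "(real n + 1) * real (a div Suc n) \<le> real a" by (simp_all add: algebra_simps)
    qed
    have u: "u n = u (Suc n) + real (I (Suc n) div Suc n) + real (S (Suc n) div Suc n)"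
      unfolding u_def by (subst I, subst S) simp
    show "(real n + 1) * u n \<le> (real n + 2) * u (Suc n)"
      "(real n + 2) * u (Suc n) - 2 * (real n + 1) \<le> (real n + 1) * u n"
      unfolding u using d[of "I (Suc n)"] d[of "S (Suc n)"] 
      by (auto simp: u_def algebra_simps)
  qed
  show "u 0 \<le> (real n + 1) * u n"
  proof (induction n)
    case (Suc n) then show ?case using step(1)[of n] by (simp add: algebra_simps)
  qed simp
  show "(real n + 1) * u n - real n * (real n + 1) \<le> u 0"
  proof (induction n)
    case (Suc n) then show ?case using step(2)[of n] by (simp add: algebra_simps)
  qed simp
qed

section \<open>Wallis integrals\<close>

text \<open>The Gamma function form of \<open>\<integral> cos\<^sup>m\<close> over \<open>[0, \<pi>/2]\<close>.\<close>

definition wallis_int :: "nat \<Rightarrow> real" where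
  "wallis_int m = sqrt pi / 2 * Gamma ((real m + 1) / 2) / Gamma (real m / 2 + 1)"

lemma wallis_int_0: "wallis_int 0 = pi / 2"
  by (simp add: wallis_int_def Gamma_one_half_real)

lemma wallis_int_1: "wallis_int (Suc 0) = 1"
proof -
  have "Gamma (1 / 2 + 1 :: real) = 1 / 2 * Gamma (1 / 2)"
    by (rule Gamma_plus1) (auto elim!: nonpos_Ints_cases')
  then show ?thesis by (simp add: wallis_int_def Gamma_one_half_real Gamma_eq_zero_iff field_simps)
qed

lemma wallis_int_pos: "0 < wallis_int m"
  by (auto simp: wallis_int_def intro!: divide_pos_pos mult_pos_pos)

lemma wallis_int_Suc_Suc: "(real m + 2) * wallis_int (Suc (Suc m)) = (real m + 1) * wallis_int m"
proof -
  have a: "Gamma ((real m + 1) / 2 + 1) = (real m + 1) / 2 * Gamma ((real m + 1) / 2)"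
    and b: "Gamma ((real m / 2 + 1) + 1) = (real m / 2 + 1) * Gamma (real m / 2 + 1)"
    by (rule Gamma_plus1; auto elim!: nonpos_Ints_cases')+
  have c: "(real (Suc (Suc m)) + 1) / 2 = (real m + 1) / 2 + 1" 
    "real (Suc (Suc m)) / 2 + 1 = (real m / 2 + 1) + 1" by (auto simp: field_simps)
  have "Gamma (real m / 2 + 1) > 0" by auto
  moreover have "real m / 2 + 1 \<noteq> 0" "2 + real m \<noteq> 0" by linarith+
  ultimately show ?thesis
    unfolding wallis_int_def c a b by (simp add: divide_simps)
qed

text \<open>Log-convexity of Gamma at the midpoint of \<open>x\<close> and \<open>x + 1\<close>
  gives \<open>Gamma (x + 1/2)\<close> squared at most
  \<open>Gamma x * Gamma (x + 1)\<close>.\<close>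

lemma wallis_int_Suc_le: "wallis_int (Suc m) \<le> wallis_int m"
proof -
  define x where "x = (real m + 1) / 2"
  have x: "x > 0" by (simp add: x_def)
  have "(ln \<circ> Gamma) ((1 - 1/2) *\<^sub>R x + (1/2) *\<^sub>R (x + 1)) \<le> (1 - 1/2) * (ln \<circ> Gamma) x + 1/2 * (ln \<circ> Gamma) (x + 1)"
    using x by (intro convex_onD[OF log_convex_Gamma_real]) auto
  moreover have "(1 - 1/2) *\<^sub>R x + (1/2) *\<^sub>R (x + 1) = x + 1/2" by (simp add: field_simps)
  ultimately have "2 * ln (Gamma (x + 1/2)) \<le> ln (Gamma x) + ln (Gamma (x + 1))" by simp
  then have "ln (Gamma (x + 1/2) * Gamma (x + 1/2)) \<le> ln (Gamma x * Gamma (x + 1))"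
    using x by (simp add: ln_mult less_imp_neq[THEN not_sym])
  then have "Gamma (x + 1/2) * Gamma (x + 1/2) \<le> Gamma x * Gamma (x + 1)"
    using x by (subst (asm) ln_le_cancel_iff) auto
  then have "Gamma (x + 1/2) / Gamma (x + 1) \<le> Gamma x / Gamma (x + 1/2)"
    using x by (simp add: field_simps)
  then have "sqrt pi / 2 * (Gamma (x + 1/2) / Gamma (x + 1)) \<le> sqrt pi / 2 * (Gamma x / Gamma (x + 1/2))"
    by (intro mult_left_mono) auto
  moreover have "(real (Suc m) + 1) / 2 = x + 1/2" "real (Suc m) / 2 + 1 = x + 1" 
      "(real m + 1) / 2 = x" "real m / 2 + 1 = x + 1/2" by (auto simp: x_def field_simps)
  ultimately show ?thesis unfolding wallis_int_def by (simp only: times_divide_eq_right)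
qed

lemma wallis_int_mult_Suc: "2 * (real m + 1) * (wallis_int m * wallis_int (Suc m)) = pi"
proof (induction m)
  case 0
  then show ?case by (simp add: wallis_int_0 wallis_int_1)
next
  case (Suc m)
  have "2 * (real m + 2) * (wallis_int (Suc m) * wallis_int (Suc (Suc m)))
     = 2 * wallis_int (Suc m) * ((real m + 2) * wallis_int (Suc (Suc m)))" by simp
  also have "\<dots> = pi" unfolding wallis_int_Suc_Suc using Suc by (simp add: algebra_simps)
  finally show ?case by (simp add: add.commute)
qed

text \<open>By monotonicity the square lies between the products with the two neighbouring
  integrals, and \<open>wallis_int_mult_Suc\<close> evaluates these exactly.\<close>

lemma wallis_int_even_bounds:
  assumes "0 < k"
  shows "pi \<le> 2 * (2 * real k + 1) * (wallis_int (2 * k))\<^sup>2"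
    and "4 * real k * (wallis_int (2 * k))\<^sup>2 \<le> pi"
proof -
  have "wallis_int (2 * k) * wallis_int (Suc (2 * k)) \<le> (wallis_int (2 * k))\<^sup>2"
    using wallis_int_Suc_le[of "2 * k"] wallis_int_pos[of "2 * k"] by (simp add: power2_eq_square)
  then have "2 * (2 * real k + 1) * (wallis_int (2 * k) * wallis_int (Suc (2 * k)))
      \<le> 2 * (2 * real k + 1) * (wallis_int (2 * k))\<^sup>2" by (intro mult_left_mono) auto
  then show "pi \<le> 2 * (2 * real k + 1) * (wallis_int (2 * k))\<^sup>2"
    using wallis_int_mult_Suc[of "2 * k"] by (simp only: of_nat_mult of_nat_numeral)
  obtain m where m: "2 * k = Suc m" using assms by (cases "2 * k") auto
  then have "real (2 * k) = real (Suc m)" by (rule arg_cong)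
  then have k: "4 * real k = 2 * (real m + 1)" by simp
  have "(wallis_int (2 * k))\<^sup>2 \<le> wallis_int m * wallis_int (Suc m)"
    using wallis_int_Suc_le[of m] wallis_int_pos[of "Suc m"] by (simp add: power2_eq_square m)
  then have "2 * (real m + 1) * (wallis_int (2 * k))\<^sup>2 \<le> 2 * (real m + 1) * (wallis_int m * wallis_int (Suc m))"
    by (intro mult_left_mono) auto
  then show "4 * real k * (wallis_int (2 * k))\<^sup>2 \<le> pi"
    using wallis_int_mult_Suc[of m] unfolding k by linarith
qed

section \<open>The linear invariant of the phase recursion\<close>

text \<open>
  The coefficients of the linear invariant: the solution of the adjoint recursion \<open>weight_rec\<close>
  that decays, namely \<open>2 \<integral> cos\<^sup>m \<theta> / (1 + cos \<theta>)\<close> over \<open>[0, \<pi>/2]\<close>.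
\<close>

definition weight :: "nat \<Rightarrow> real" where
  "weight m = 2 * ((real m + 1) * wallis_int (Suc m) - real m * wallis_int m)"

lemma weight_add_Suc: "weight m + weight (Suc m) = 2 * wallis_int m"
  using wallis_int_Suc_Suc[of m] by (simp add: weight_def algebra_simps)

text \<open>For \<open>m = l + 1\<close> the recurrence turns the weight into
  \<open>2 * (l + 1) * (wallis_int l - wallis_int (l + 1))\<close>.\<close>

lemma weight_nonneg: "0 \<le> weight m"
proof (cases m)
  case (Suc l)
  show ?thesis
    using wallis_int_Suc_Suc[of l] wallis_int_Suc_le[of l] 
      mult_left_mono[OF wallis_int_Suc_le[of l], of "real l + 1"]
    by (simp add: weight_def Suc algebra_simps)
qed (simp add: weight_def wallis_int_1)

lemma weight_rec: "weight m = weight (Suc m) / (real m + 1) + weight (Suc (Suc m))"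
proof -
  have "weight m - weight (Suc (Suc m)) = 2 * wallis_int m - 2 * wallis_int (Suc m)"
    using weight_add_Suc[of m] weight_add_Suc[of "Suc m"] by simp
  moreover have "weight (Suc m) = (real m + 1) * (2 * wallis_int m - 2 * wallis_int (Suc m))"
    using wallis_int_Suc_Suc[of m] by (simp add: weight_def algebra_simps)
  ultimately have "weight (Suc m) = (real m + 1) * (weight m - weight (Suc (Suc m)))" by simp
  then show ?thesis by simp
qed

text \<open>By \<open>weight_rec\<close> both unrounded updates preserve the combination, and its
  initial value is \<rho> because the first two weights are 2 and \<open>pi - 2\<close>. Rounding
  only lowers it, in round \<open>k\<close> by at most \<open>weight (2 * k + 1) + weight (2 * k +
  2) = 2 * wallis_int (2 * k + 1)\<close>.\<close>

lemma phase_weight: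
  fixes i j k :: nat
  assumes "phase i (i + j) k = (D, C)"
  defines "\<rho> \<equiv> pi * real i + 2 * real j"
  shows "weight (2 * k) * real C + weight (2 * k + 1) * real D \<le> \<rho>"
    and "\<rho> - 2 * (2 * real k + 1) * wallis_int (2 * k) \<le> weight (2 * k) * real C + weight (2 * k + 1) * real D"
proof -
  have floor: "real a / real d - 1 \<le> real (a div d)" "real (a div d) \<le> real a / real d" if "0 < d" for a d :: nat
    using nat_div_bounds[OF that, of a] that by (simp_all add: field_simps flip: of_nat_mult of_nat_add)
  define L where "L = weight (2 * k) * real C + weight (2 * k + 1) * real D"
  \<comment> \<open>The losses telescope: \<open>2 * (2 * k + 1) * wallis_int (2 * k + 1)\<close>
    grows by exactly \<open>2 * wallis_int (2 * k + 1)\<close> per round. It starts at 2, which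
    explains the \<open>+ 2\<close>.\<close>
  have "L \<le> \<rho> \<and> \<rho> + 2 - 2 * (2 * real k + 1) * wallis_int (2 * k + 1) \<le> L"
    unfolding L_def using assms(1)
  proof (induction k arbitrary: D C)
    case 0
    have w: "weight 0 = 2" "weight (Suc 0) = pi - 2"
      using weight_add_Suc[of 0] by (simp_all add: weight_def wallis_int_0 wallis_int_1)
    have "D = i" "C = i + j" using 0 by simp_all
    then show ?case by (simp add: w \<rho>_def wallis_int_1 algebra_simps)
  next
    case (Suc k)
    obtain D0 C0 where p: "phase i (i + j) k = (D0, C0)" by fastforce
    define x y where "x = real (C0 div (2 * k + 1))" and "y = real ((D0 + C0 div (2 * k + 1)) div (2 * k + 2))"
    have D: "real D = D0 + x" and C: "real C = C0 + y"
      using Suc.prems p by (auto simp: Let_def x_def y_def)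
    have x: "real C0 / (2 * real k + 1) - 1 \<le> x" "x \<le> real C0 / (2 * real k + 1)"
      using floor[of "2 * k + 1" C0] by (simp_all add: x_def add.commute)
    have y: "real D / (2 * real k + 2) - 1 \<le> y" "y \<le> real D / (2 * real k + 2)"
      using floor[of "2 * k + 2" "D0 + C0 div (2 * k + 1)"] 
      by (simp_all add: y_def D x_def add.commute)
    define w where "w = (\<lambda>l. weight (2 * k + l))"
    have w0: "w 0 = w 1 / (2 * real k + 1) + w 2" and w1: "w 1 = w 2 / (2 * real k + 2) + w 3"
      using weight_rec[of "2 * k"] weight_rec[of "2 * k + 1"]
      by (simp_all add: w_def numeral_3_eq_3 numeral_2_eq_2 add.commute)
    have wn: "0 \<le> w 1" "0 \<le> w 2" using weight_nonneg by (auto simp: w_def)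
    have w12: "w 1 + w 2 = 2 * wallis_int (2 * k + 1)"
      using weight_add_Suc[of "2 * k + 1"] by (simp add: w_def)
    have IH: "w 0 * C0 + w 1 * D0 \<le> \<rho>"
      "\<rho> + 2 - 2 * (2 * real k + 1) * wallis_int (2 * k + 1) \<le> w 0 * C0 + w 1 * D0"
      using Suc.IH[OF p] by (auto simp: w_def)
    have 1: "w 1 * x \<le> w 1 * (C0 / (2 * real k + 1))" "w 1 * (C0 / (2 * real k + 1) - 1) \<le> w 1 * x"
      using mult_left_mono[OF x(2) wn(1)] mult_left_mono[OF x(1) wn(1)] .
    have 2: "w 2 * y \<le> w 2 * (D / (2 * real k + 2))" "w 2 * (D / (2 * real k + 2) - 1) \<le> w 2 * y"
      using mult_left_mono[OF y(2) wn(2)] mult_left_mono[OF y(1) wn(2)] .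
    have 3: "w 0 * C0 = w 1 * (C0 / (2 * real k + 1)) + w 2 * C0" unfolding w0 by (simp add: algebra_simps)
    have 4: "w 1 * D = w 2 * (D / (2 * real k + 2)) + w 3 * D" by (subst w1) (simp add: algebra_simps)
    have 5: "w 1 * D = w 1 * D0 + w 1 * x" unfolding D by (simp add: algebra_simps)
    have 6: "w 2 * C = w 2 * C0 + w 2 * y" unfolding C by (simp add: algebra_simps)
    have 7: "(2 * real k + 3) * wallis_int (2 * k + 3) = (2 * real k + 2) * wallis_int (2 * k + 1)"
      using wallis_int_Suc_Suc[of "2 * k + 1"] by (simp add: numeral_3_eq_3 add.commute)
    have "w 2 * C + w 3 * D \<le> \<rho>" using 1 2 3 4 5 6 IH by linarith
    moreover have "\<rho> + 2 - 2 * (2 * real k + 1) * wallis_int (2 * k + 1) - (w 1 + w 2) \<le> w 2 * C + w 3 * D"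
      using 1 2 3 4 5 6 IH by (simp add: algebra_simps)
    then have "\<rho> + 2 - 2 * ((2 * real k + 3) * wallis_int (2 * k + 3)) \<le> w 2 * C + w 3 * D"
      unfolding w12 7 by (simp add: algebra_simps)
    ultimately show ?case by (simp add: w_def algebra_simps numeral_3_eq_3)
  qed
  moreover have "2 * (2 * real k + 1) * wallis_int (2 * k + 1) \<le> 2 * (2 * real k + 1) * wallis_int (2 * k)"
    using wallis_int_Suc_le[of "2 * k"] by (intro mult_left_mono) auto
  ultimately show "weight (2 * k) * real C + weight (2 * k + 1) * real D \<le> \<rho>"
   "\<rho> - 2 * (2 * real k + 1) * wallis_int (2 * k) \<le> weight (2 * k) * real C + weight (2 * k + 1) * real D"
    unfolding L_def by linarith+
qed


section \<open>From \<open>rho\<close> to the size of the entries\<close>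

text \<open>Apart from rounding, \<open>D\<close> and \<open>C\<close> are near
  \<open>sqrt (2 * \<kappa>) * x\<close>, and \<open>T\<close> is about
  \<open>D * C / (2 * \<kappa>)\<close>, hence about \<open>x\<close> squared. The shift by
  \<open>sqrt \<kappa>\<close> pays for rounding in the phases, the factor with
  \<open>1 / \<kappa>\<close> for the gap between \<open>C\<close> and \<open>D\<close>, for the
  Wallis bounds and for the remaining \<open>M\<close> steps.\<close>

lemma tchoukaillon_bounds:
  fixes i j k :: nat
  assumes "0 < k"
  defines "\<kappa> \<equiv> 2 * real k" and "x \<equiv> rho i j / (2 * sqrt pi)"
  shows "real (tchoukaillon i j) \<le> ((x + sqrt \<kappa>) * (1 + 1 / \<kappa>))\<^sup>2 + 1"
    and "(x - 2 * sqrt \<kappa>) * (1 - 1 / \<kappa>) \<le> sqrt (real (tchoukaillon i j))"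
proof -
  define T where "T = real (tchoukaillon i j)"
  obtain I S where init: "I (i + j) = i" "S (i + j) = i + j"
    and I: "\<And>n. I n = I (Suc n) + S (Suc n) div Suc n"
    and S: "\<And>n. S n = S (Suc n) + I (Suc n) div Suc n"
    and le: "\<And>n. I n \<le> S n" and gap: "\<And>n. S n \<le> I n + n" and T: "tchoukaillon i j = Suc (I 0)"
    using tchoukaillon_trajectory[of i j] by metis
  obtain D C where DC: "phase i (i + j) k = (D, C)" by fastforce
  obtain l where l: "k = Suc l" using assms by (cases k) auto
  define M where "M = D div (2 * k)"
  have M': "M = D div (2 * l + 2)" by (simp add: M_def l)
  have IM: "I M + k * M = D" and SM: "S M + k * M = C"
    using phase_trajectory[OF init I S le gap DC[unfolded l]] by (simp_all only: l M')
  have u: "real (I M) + real (S M) = real C + real D - \<kappa> * real M"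
    by (simp add: \<kappa>_def flip: IM SM)
  have "2 * k * M \<le> D" "D < 2 * k * Suc M"
    unfolding M_def using assms by (intro nat_div_bounds; simp)+
  then have "real (2 * k * M) \<le> D" "D < real (2 * k * Suc M)" by linarith+
  then have M: "\<kappa> * M \<le> D" "D < \<kappa> * (real M + 1)" by (simp_all add: \<kappa>_def algebra_simps)
  have "D \<le> C" "C \<le> D + M" using le[of M] gap[of M] IM SM by auto
  then have DC_le: "real D \<le> C" "real C \<le> real D + real M" by linarith+
  have \<kappa>: "2 \<le> \<kappa>" using assms by (simp add: \<kappa>_def)
  have "2 * (T - 1) = real (I 0) + real (S 0)" using le[of 0] gap[of 0] by (simp add: T_def T)
  then have up: "2 * (T - 1) \<le> (real M + 1) * (real C + real D - \<kappa> * real M)"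
    and low: "(real M + 1) * (real C + real D - \<kappa> * real M) - real M * (real M + 1) \<le> 2 * (T - 1)"
    using trajectory_total[OF I S, of M] unfolding u by simp_all
  define W where "W = wallis_int (2 * k)"
  \<comment> \<open>\<open>R\<close> is the common value that \<open>D\<close> and \<open>C\<close>
    would have if they were equal and the invariant suffered no rounding, as the two weights add up
    to \<open>2 * W\<close>.\<close>
  define R where "R = sqrt pi * x / W"
  have W: "0 < W" by (simp add: W_def wallis_int_pos)
  have x: "0 \<le> x" by (simp add: x_def rho_def)
  have rho: "rho i j = 2 * W * R" using W by (simp add: R_def x_def)
  have w: "0 \<le> weight (2 * k)" "0 \<le> weight (2 * k + 1)" "weight (2 * k) + weight (2 * k + 1) = 2 * W"
    using weight_nonneg weight_add_Suc[of "2 * k"] by (auto simp: W_def)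
  note L = phase_weight[OF DC, folded rho_def W_def \<kappa>_def]
  have "(2 * W) * D = weight (2 * k) * D + weight (2 * k + 1) * D" by (simp only: w(3)[symmetric] distrib_right)
  also have "\<dots> \<le> (2 * W) * R"
    using L(1) mult_left_mono[OF DC_le(1) w(1)] unfolding rho by linarith
  finally have DR: "D \<le> R" using W by simp
  have "(2 * W) * (R - (\<kappa> + 1)) \<le> weight (2 * k) * C + weight (2 * k + 1) * D"
    using L(2) unfolding rho by (simp add: algebra_simps)
  also have "\<dots> \<le> weight (2 * k) * C + weight (2 * k + 1) * C"
    using mult_left_mono[OF DC_le(1) w(2)] by linarith
  also have "\<dots> = (2 * W) * C" by (simp only: w(3)[symmetric] distrib_right)
  finally have CR: "R - (\<kappa> + 1) \<le> C" using W by simp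
  note Wb = wallis_int_even_bounds[OF assms(1), folded W_def \<kappa>_def]
  define t where "t = sqrt (2 * (\<kappa> + 1))"
  have "sqrt pi \<le> sqrt (2 * (\<kappa> + 1) * W\<^sup>2)" using Wb(1) by simp
  then have "sqrt pi \<le> t * W" using W by (simp add: t_def real_sqrt_mult)
  then have "sqrt pi * x \<le> t * W * x" using x by (rule mult_right_mono)
  then have Rt: "R \<le> t * x" using W by (simp add: R_def field_simps)
  have "sqrt (2 * \<kappa> * W\<^sup>2) \<le> sqrt pi" using Wb(2) by (simp add: \<kappa>_def)
  then have "sqrt (2 * \<kappa>) * W \<le> sqrt pi" using W by (simp add: real_sqrt_mult)
  then have "sqrt (2 * \<kappa>) * W * x \<le> sqrt pi * x" using x by (rule mult_right_mono)
  then have tR: "sqrt (2 * \<kappa>) * x \<le> R" using W by (simp add: R_def field_simps)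
  have R0: "0 \<le> R" using DR by linarith

  have MD: "M \<le> D / \<kappa>" "D / \<kappa> \<le> real M + 1" using M \<kappa> by (simp_all add: field_simps)
  have DRk: "D / \<kappa> \<le> R / \<kappa>" using DR \<kappa> by (intro divide_right_mono) auto

  have "\<kappa> = sqrt \<kappa> * sqrt \<kappa>" using \<kappa> by simp
  also have "\<dots> \<le> t * sqrt \<kappa>" unfolding t_def using \<kappa> by (intro mult_right_mono) auto
  finally have "R + \<kappa> \<le> t * (x + sqrt \<kappa>)" using Rt by (simp add: algebra_simps)
  then have "(R + \<kappa>)\<^sup>2 \<le> (t * (x + sqrt \<kappa>))\<^sup>2" using R0 \<kappa> by (intro power_mono) auto
  also have "\<dots> = 2 * (\<kappa> + 1) * (x + sqrt \<kappa>)\<^sup>2" using \<kappa> by (simp add: t_def power_mult_distrib)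
  finally have sq: "(R + \<kappa>)\<^sup>2 \<le> 2 * (\<kappa> + 1) * (x + sqrt \<kappa>)\<^sup>2" .
  have "2 * (T - 1) \<le> (real M + 1) * (real C + real D - \<kappa> * real M)" by (fact up)
  also have "\<dots> \<le> (R / \<kappa> + 1) * (R + R / \<kappa> + \<kappa>)"
    using M MD DRk DR DC_le by (intro mult_mono) (auto simp: algebra_simps)
  also have "\<dots> = (R + \<kappa>) * (R + \<kappa> + R / \<kappa>) / \<kappa>" using \<kappa> by (simp add: field_simps)
  also have "\<dots> \<le> (R + \<kappa>) * (R + \<kappa> + (R + \<kappa>) / \<kappa>) / \<kappa>"
    using \<kappa> R0 by (intro divide_right_mono mult_left_mono add_left_mono) auto
  also have "\<dots> = (R + \<kappa>)\<^sup>2 * ((1 + 1 / \<kappa>) / \<kappa>)" using \<kappa> by (simp add: field_simps power2_eq_square)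
  also have "\<dots> \<le> 2 * (\<kappa> + 1) * (x + sqrt \<kappa>)\<^sup>2 * ((1 + 1 / \<kappa>) / \<kappa>)"
    using \<kappa> sq by (intro mult_right_mono) auto
  also have "\<dots> = 2 * ((x + sqrt \<kappa>) * (1 + 1 / \<kappa>))\<^sup>2"
    using \<kappa> by (simp add: field_simps power2_eq_square)
  finally show "real (tchoukaillon i j) \<le> ((x + sqrt \<kappa>) * (1 + 1 / \<kappa>))\<^sup>2 + 1"
    by (simp add: T_def)

  \<comment> \<open>Since \<open>M \<le> C / \<kappa>\<close>, this \<open>y\<close> lies below both
    \<open>D\<close> and \<open>C - M\<close>, so its square bounds the product of the two factors
    from below.\<close>
  define y where "y = C * (1 - 1 / \<kappa>)"
  have "D / \<kappa> \<le> C / \<kappa>" using DC_le \<kappa> by (intro divide_right_mono) auto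
  then have MC: "M \<le> C / \<kappa>" using MD by linarith
  then have y: "y \<le> real C - real M" "y \<le> D" using DC_le by (simp_all add: y_def algebra_simps)
  have y0: "0 \<le> y" using \<kappa> by (simp add: y_def)
  have "y * y \<le> \<kappa> * (real M + 1) * (real C - real M)"
    using y y0 M by (intro mult_mono) auto
  also have "\<dots> = \<kappa> * ((real M + 1) * (real C - real M))" by simp
  also have "\<dots> \<le> \<kappa> * ((real M + 1) * (real C + real D - \<kappa> * real M - real M))"
    using M \<kappa> by (intro mult_left_mono) auto
  also have "\<dots> \<le> \<kappa> * (2 * T)" using low \<kappa> by (intro mult_left_mono) (auto simp: algebra_simps)
  finally have "y\<^sup>2 \<le> 2 * \<kappa> * T" by (simp add: power2_eq_square)
  then have "sqrt (y\<^sup>2) \<le> sqrt (2 * \<kappa> * T)" by (rule real_sqrt_le_mono)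
  then have yT: "y \<le> sqrt (2 * \<kappa>) * sqrt T" using y0 by (simp add: real_sqrt_mult)
  have "sqrt (2 * \<kappa>) * (2 * sqrt \<kappa>) = 2 * sqrt 2 * \<kappa>" using \<kappa> by (simp add: real_sqrt_mult)
  moreover have "1 * \<kappa> \<le> sqrt 2 * \<kappa>" using \<kappa> by (intro mult_right_mono) auto
  ultimately have "\<kappa> + 1 \<le> sqrt (2 * \<kappa>) * (2 * sqrt \<kappa>)" using \<kappa> by linarith
  then have "sqrt (2 * \<kappa>) * (x - 2 * sqrt \<kappa>) \<le> C" using CR tR by (simp add: algebra_simps)
  then have "sqrt (2 * \<kappa>) * (x - 2 * sqrt \<kappa>) * (1 - 1 / \<kappa>) \<le> y"
    unfolding y_def using \<kappa> by (intro mult_right_mono) auto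
  then have "sqrt (2 * \<kappa>) * ((x - 2 * sqrt \<kappa>) * (1 - 1 / \<kappa>)) \<le> sqrt (2 * \<kappa>) * sqrt T"
    using yT by (simp add: mult.assoc)
  then show "(x - 2 * sqrt \<kappa>) * (1 - 1 / \<kappa>) \<le> sqrt (real (tchoukaillon i j))"
    using \<kappa> by (simp add: T_def)
qed

section \<open>Choice of the cutoff\<close>

text \<open>With \<open>k\<close> about \<open>v\<^sup>2\<close>, the shift
  \<open>sqrt \<kappa>\<close> and the relative error \<open>1 / \<kappa>\<close> of
  \<open>sqrt V = v ^ 3\<close> are both worth \<open>O(v)\<close>. In all, \<open>x\<close> is
  within \<open>5 * v\<close> of \<open>v ^ 3\<close>. Multiplying by
  \<open>2 * sqrt pi \<le> 4\<close> costs \<open>20 * v\<close>, and \<open>2 * v\<close> more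
  absorbs the constant 2.\<close>

lemma tregion_bounds:
  fixes V :: nat
  assumes "1 \<le> V"
  defines "v \<equiv> real V powr (1 / 6)"
  shows "rho i j \<le> 2 * sqrt (pi * real V) - 2 - 22 * v \<Longrightarrow> (i, j) \<in> tregion V"
    and "(i, j) \<in> tregion V \<Longrightarrow> rho i j \<le> 2 * sqrt (pi * real V) - 2 + 22 * v"
proof -
  define x where "x = rho i j / (2 * sqrt pi)"
  define k where "k = nat \<lceil>v\<^sup>2\<rceil>"
  define \<kappa> where "\<kappa> = 2 * real k"
  have v1: "1 \<le> v" using assms by (simp add: v_def ge_one_powr_ge_zero)
  have V: "real V = v ^ 6" using assms by (simp add: v_def powr_powr flip: powr_numeral)
  have sqV: "sqrt (real V) = v ^ 3" using v1 by (intro real_sqrt_unique) (auto simp: V)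
  have v2: "1 \<le> v\<^sup>2" using v1 by simp
  have k: "v\<^sup>2 \<le> real k" "real k < v\<^sup>2 + 1" using v2 by (auto simp: k_def) linarith+
  then have k0: "0 < k" using v2 by linarith
  have \<kappa>: "2 * v\<^sup>2 \<le> \<kappa>" "\<kappa> \<le> 4 * v\<^sup>2" using k v2 by (auto simp: \<kappa>_def)
  have sq\<kappa>: "sqrt \<kappa> \<le> 2 * v" using \<kappa> v1 by (intro real_le_lsqrt) (auto simp: power_mult_distrib)
  have \<kappa>0: "0 < \<kappa>" using \<kappa> v2 by linarith
  have inv: "1 / \<kappa> \<le> 1 / (2 * v\<^sup>2)" using \<kappa> \<kappa>0 v1 by (intro divide_left_mono) auto
  define p where "p = sqrt pi"
  have p: "0 < p" "p \<le> 2"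
    using real_sqrt_le_mono[of pi 4] pi_less_4 by (auto simp: p_def)
  have rho: "rho i j = 2 * p * x" using p by (simp add: x_def p_def)
  have spV: "sqrt (pi * real V) = p * v ^ 3" by (simp add: real_sqrt_mult p_def sqV)
  have x0: "0 \<le> x" by (simp add: x_def rho_def)
  note b = tchoukaillon_bounds[OF k0, of i j, folded \<kappa>_def x_def]
  have pv: "p * v \<le> 2 * v" using p v1 by (intro mult_right_mono) auto
  show "(i, j) \<in> tregion V" if "rho i j \<le> 2 * sqrt (pi * real V) - 2 - 22 * v"
  proof -
    have "2 * (p * x) \<le> 2 * (p * v ^ 3) - 2 - 22 * v" using that by (simp add: rho spV)
    then have "p * x \<le> p * v ^ 3 - 5 * (p * v)" using pv v1 by linarith
    then have "p * x \<le> p * (v ^ 3 - 5 * v)" by (simp add: algebra_simps)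
    then have x: "x \<le> v ^ 3 - 5 * v" using p by simp
    have "(x + sqrt \<kappa>) * (1 + 1 / \<kappa>) \<le> (v ^ 3 - 3 * v) * (1 + 1 / (2 * v\<^sup>2))"
      using x sq\<kappa> inv x0 v1 \<kappa> v2 by (intro mult_mono) auto
    also have "\<dots> = v ^ 3 - 5 / 2 * v - 3 / (2 * v)"
      using v1 by (simp add: field_simps power2_eq_square power3_eq_cube)
    also have "\<dots> \<le> v ^ 3 - v"
    proof -
      have "0 \<le> 3 / (2 * v)" using v1 by simp
      then show ?thesis using v1 by linarith
    qed
    \<comment> \<open>The margin \<open>v\<close> below \<open>v ^ 3\<close> is kept so that the
      square also absorbs the additive 1 of the upper bound.\<close>
    finally have "((x + sqrt \<kappa>) * (1 + 1 / \<kappa>))\<^sup>2 \<le> (v ^ 3 - v)\<^sup>2"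
      using x0 \<kappa> v2 by (intro power_mono) auto
    then have "real (tchoukaillon i j) \<le> (v ^ 3 - v)\<^sup>2 + 1" using b(1) by linarith
    also have "\<dots> = v ^ 6 - v\<^sup>2 * (v\<^sup>2 - 1) - (v\<^sup>2 * v\<^sup>2 - 1)"
      by (simp add: algebra_simps power2_eq_square power3_eq_cube eval_nat_numeral)
    also have "\<dots> \<le> v ^ 6"
    proof -
      have "0 \<le> v\<^sup>2 * (v\<^sup>2 - 1)" using v2 by simp
      moreover have "1 * 1 \<le> v\<^sup>2 * v\<^sup>2" using v2 by (intro mult_mono) auto
      ultimately show ?thesis by linarith
    qed
    finally show ?thesis by (simp add: tregion_def flip: V)
  qed
  show "rho i j \<le> 2 * sqrt (pi * real V) - 2 + 22 * v" if "(i, j) \<in> tregion V"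
  proof -
    have "real (tchoukaillon i j) \<le> real V" using that by (simp add: tregion_def)
    then have "sqrt (real (tchoukaillon i j)) \<le> v ^ 3" by (simp flip: sqV)
    then have "(x - 2 * sqrt \<kappa>) * (1 - 1 / \<kappa>) \<le> v ^ 3" using b(2) by linarith
    \<comment> \<open>The factor \<open>1 + 2 / \<kappa>\<close> undoes
      \<open>1 - 1 / \<kappa>\<close>: for \<open>\<kappa> \<ge> 2\<close> their product is at least
      1.\<close>
    then have "(x - 2 * sqrt \<kappa>) * (1 - 1 / \<kappa>) * (1 + 2 / \<kappa>) \<le> v ^ 3 * (1 + 2 / \<kappa>)"
      using \<kappa> v2 by (intro mult_right_mono) auto
    moreover have "(1 - 1 / \<kappa>) * (1 + 2 / \<kappa>) \<ge> 1"
      using \<kappa> v2 by (simp add: field_simps)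
    then have "x - 2 * sqrt \<kappa> \<le> (x - 2 * sqrt \<kappa>) * ((1 - 1 / \<kappa>) * (1 + 2 / \<kappa>))"
      if "0 \<le> x - 2 * sqrt \<kappa>" using mult_left_mono[OF _ that] by fastforce
    moreover have "0 \<le> v ^ 3 * (1 + 2 / \<kappa>)" using \<kappa> v1 v2 by simp
    ultimately have "x - 2 * sqrt \<kappa> \<le> v ^ 3 * (1 + 2 / \<kappa>)"
      by (cases "0 \<le> x - 2 * sqrt \<kappa>") (auto simp: mult.assoc)
    also have "\<dots> \<le> v ^ 3 * (1 + 2 / (2 * v\<^sup>2))"
      using inv v1 by (intro mult_left_mono) auto
    also have "\<dots> = v ^ 3 + v" using v1 by (simp add: field_simps power2_eq_square power3_eq_cube)
    finally have "x \<le> v ^ 3 + 5 * v" using sq\<kappa> by linarith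
    then have "p * x \<le> p * (v ^ 3 + 5 * v)" using p by (intro mult_left_mono) auto
    then have "p * x \<le> p * v ^ 3 + 5 * (p * v)" by (simp add: algebra_simps)
    then have "2 * (p * x) \<le> 2 * (p * v ^ 3) - 2 + 22 * v" using pv v1 by linarith
    then show ?thesis by (simp add: rho spV)
  qed
qed

theorem corollary2:
  shows "\<exists>K::real. \<forall>\<^sub>F V::nat in sequentially.
    {(i, j). rho i j \<le> 2 * sqrt (pi * real V) - 2 - K * real V powr (1 / 6)} \<subseteq> tregion V \<and>
    tregion V \<subseteq> {(i, j). rho i j \<le> 2 * sqrt (pi * real V) - 2 + K * real V powr (1 / 6)}"
  by (intro exI[of _ 22] eventually_mono[OF eventually_ge_at_top[of 1]] conjI subsetI; clarify)
    (simp_all add: tregion_bounds)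

end
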